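(* Let $H$ be a complex Hilbert space, let $R_0$ be a trace-class positive operator on $H$, and let $(u_n)_{n\ge 0}$ be a sequence of unit vectors in $H$. Define $R_{n+1}=R_n^{1/2}(I-|u_n\rangle\langle u_n|)R_n^{1/2}$ for $n\ge 0$, and let $R_\infty$ be the strong operator limit of $(R_n)$. Fix $c\in(0,1]$. If $$\langle u_n,R_nu_n\rangle\ge c\|R_n\|\qquad\text{for all }n\ge 0,$$ then $R_n\to 0$ in operator norm, hence $R_\infty=0$.
   Context: Inner products are linear in the second variable. $|a\rangle\langle b|$ denotes the operator $x\mapsto\langle b,x\rangle a$. Each $R_n$ is a bounded positive operator, and the sequence $(R_n)$ is decreasing in the Löwner order and bounded below by $0$, so it converges in the strong operator topology to some bounded positive operator $R_\infty$ (if some $R_n=0$, then $R_k=0$ for all $k\ge n$). *)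

theory Defs
  imports "HOL-Analysis.Analysis"
begin

section \<open>Complex Hilbert spaces\<close>

text \<open>The inner product is linear in the second argument. The axiom \<open>cinner_self\<close> ties it to
  the norm inherited from \<^class>\<open>real_normed_vector\<close>; positive definiteness follows from it and the
  norm axioms.\<close>

class complex_inner = real_normed_vector +
  fixes scaleC :: "complex \<Rightarrow> 'a \<Rightarrow> 'a" (infixr "*\<^sub>C" 75)
    and cinner :: "'a \<Rightarrow> 'a \<Rightarrow> complex"
  assumes scaleC_add_right: "a *\<^sub>C (x + y) = a *\<^sub>C x + a *\<^sub>C y"
    and scaleC_add_left: "(a + b) *\<^sub>C x = a *\<^sub>C x + b *\<^sub>C x"
    and scaleC_scaleC: "a *\<^sub>C (b *\<^sub>C x) = (a * b) *\<^sub>C x"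
    and scaleR_scaleC: "r *\<^sub>R x = complex_of_real r *\<^sub>C x"
    and cinner_commute: "cinner x y = cnj (cinner y x)"
    and cinner_add_right: "cinner x (y + z) = cinner x y + cinner x z"
    and cinner_scaleC_right: "cinner x (a *\<^sub>C y) = a * cinner x y"
    and cinner_self: "cinner x x = complex_of_real ((norm x)\<^sup>2)"

class chilbert_space = complex_inner + banach

instantiation complex :: chilbert_space
begin

definition scaleC_complex :: "complex \<Rightarrow> complex \<Rightarrow> complex"
  where "scaleC_complex a x = a * x"

definition cinner_complex :: "complex \<Rightarrow> complex \<Rightarrow> complex"
  where "cinner_complex x y = cnj x * y"

instance
proof
  show "cinner x x = complex_of_real ((norm x)\<^sup>2)" for x :: complex
    unfolding cinner_complex_def
    by (metis complex_norm_square mult.commute)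
qed (auto simp: scaleC_complex_def cinner_complex_def distrib_left distrib_right scaleR_conv_of_real)

end

global_interpretation complex_vector:
  vector_space "scaleC :: complex \<Rightarrow> 'a \<Rightarrow> 'a::complex_inner"
  defines cspan = complex_vector.span
proof
  show "1 *\<^sub>C x = x" for x :: 'a
    using scaleR_scaleC[of 1 x] by simp
qed (simp_all add: scaleC_add_right scaleC_add_left scaleC_scaleC)

lemma cinner_add_left: "cinner (x + y) z = cinner x z + cinner y z"
  using cinner_commute[of "x + y" z] cinner_commute[of x z] cinner_commute[of y z]
  by (simp only: cinner_add_right complex_cnj_add)

lemma cinner_scaleC_left: "cinner (a *\<^sub>C x) y = cnj a * cinner x y"
  using cinner_commute[of "a *\<^sub>C x" y] cinner_commute[of x y]
  by (simp only: cinner_scaleC_right complex_cnj_mult)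

lemma norm_scaleC: "norm (a *\<^sub>C x) = cmod a * norm x"
proof -
  have "complex_of_real ((norm (a *\<^sub>C x))\<^sup>2) = a * (cnj a * cinner x x)"
    by (simp only: cinner_self [symmetric] cinner_scaleC_left cinner_scaleC_right)
  also have "\<dots> = complex_of_real ((cmod a * norm x)\<^sup>2)"
    unfolding cinner_self using complex_norm_square[of a]
    by (simp add: power_mult_distrib)
  finally have "(norm (a *\<^sub>C x))\<^sup>2 = (cmod a * norm x)\<^sup>2"
    by (simp only: of_real_eq_iff)
  then show ?thesis
    by (simp add: power2_eq_iff_nonneg)
qed

lemma Re_cinner_le: "Re (cinner x y) \<le> norm x * norm y"
proof (cases "x = 0 \<or> y = 0")
  case True
  have "cinner x 0 = 0" "cinner 0 y = 0"
    using cinner_add_right[of x 0 0] cinner_add_left[of 0 0 y] by auto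
  then show ?thesis
    using True by auto
next
  case False
  define a where "a = complex_of_real (norm y)"
  define b where "b = complex_of_real (- norm x)"
  have pos: "norm x * norm y > 0"
    using False by simp
  have com: "cinner y x = cnj (cinner x y)"
    by (rule cinner_commute)
  have expand: "cinner (a *\<^sub>C x + b *\<^sub>C y) (a *\<^sub>C x + b *\<^sub>C y)
      = a * (cnj a * cinner x x + cnj b * cnj (cinner x y))
        + b * (cnj a * cinner x y + cnj b * cinner y y)"
    by (simp only: cinner_add_left cinner_add_right cinner_scaleC_left cinner_scaleC_right com)
  have "Re (cinner (a *\<^sub>C x + b *\<^sub>C y) (a *\<^sub>C x + b *\<^sub>C y))
      = 2 * (norm x * norm y) * (norm x * norm y - Re (cinner x y))"
    unfolding expand unfolding cinner_self a_def b_def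
    by (simp add: power2_eq_square algebra_simps)
  moreover have "0 \<le> Re (cinner (a *\<^sub>C x + b *\<^sub>C y) (a *\<^sub>C x + b *\<^sub>C y))"
    unfolding cinner_self by simp
  ultimately have "0 \<le> 2 * (norm x * norm y) * (norm x * norm y - Re (cinner x y))"
    by simp
  then show ?thesis
    using pos by (simp add: zero_le_mult_iff)
qed

lemma norm_cinner_le: "cmod (cinner x y) \<le> norm x * norm y"
proof -
  obtain a where a: "cmod a = 1" "a * cinner x y = complex_of_real (cmod (cinner x y))"
  proof (cases "cinner x y = 0")
    case True
    then show ?thesis using that[of 1] by simp
  next
    case False
    let ?w = "cinner x y"
    have "cnj ?w / complex_of_real (cmod ?w) * ?w = complex_of_real (cmod ?w)"
      using False complex_norm_square[of ?w] by (simp add: field_simps power2_eq_square)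
    moreover have "cmod (cnj ?w / complex_of_real (cmod ?w)) = 1"
      using False by (simp add: norm_divide)
    ultimately show ?thesis using that by blast
  qed
  have "cmod (cinner x y) = Re (cinner x (a *\<^sub>C y))"
    by (simp add: cinner_scaleC_right a(2))
  also have "\<dots> \<le> norm x * norm (a *\<^sub>C y)"
    by (rule Re_cinner_le)
  finally show ?thesis
    by (simp add: norm_scaleC a(1))
qed

definition is_onb :: "'a::complex_inner set \<Rightarrow> bool"
  where "is_onb E \<longleftrightarrow>
    (\<forall>e\<in>E. norm e = 1) \<and> (\<forall>e\<in>E. \<forall>f\<in>E. e \<noteq> f \<longrightarrow> cinner e f = 0) \<and> closure (cspan E) = UNIV"

section \<open>Bounded operators\<close>

text \<open>The type \<^typ>\<open>'a \<Rightarrow>\<^sub>L 'a\<close> contains all bounded \<^emph>\<open>real\<close>-linear maps; its norm is the usual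
  operator norm. Bounded operators in the sense of complex Hilbert spaces are the elements
  satisfying \<open>clinear_op\<close>.\<close>

definition clinear_op :: "('a::complex_inner \<Rightarrow>\<^sub>L 'a) \<Rightarrow> bool"
  where "clinear_op A \<longleftrightarrow> Vector_Spaces.linear scaleC scaleC (blinfun_apply A)"

lift_definition ketbra :: "'a::complex_inner \<Rightarrow> 'a \<Rightarrow> 'a \<Rightarrow>\<^sub>L 'a"
  is "\<lambda>a b x. cinner b x *\<^sub>C a"
proof -
  fix a b :: 'a
  show "bounded_linear (\<lambda>x. cinner b x *\<^sub>C a)"
  proof (rule bounded_linear_intro[where K = "norm b * norm a"])
    show "norm (cinner b x *\<^sub>C a) \<le> norm x * (norm b * norm a)" for x
      using mult_right_mono[OF norm_cinner_le[of b x] norm_ge_zero[of a]]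
      by (simp add: norm_scaleC mult_ac)
  qed (simp_all add: cinner_add_right cinner_scaleC_right scaleC_add_left scaleR_scaleC scaleC_scaleC)
qed

text \<open>On a complex space, realness of the quadratic form already forces self-adjointness.\<close>

definition positive_op :: "('a::complex_inner \<Rightarrow>\<^sub>L 'a) \<Rightarrow> bool"
  where "positive_op A \<longleftrightarrow> clinear_op A \<and> (\<forall>x. cinner x (A x) \<in> \<real>\<^sub>\<ge>\<^sub>0)"

text \<open>The positive square root; meaningful for positive operators on a Hilbert space.\<close>

definition op_sqrt :: "('a::chilbert_space \<Rightarrow>\<^sub>L 'a) \<Rightarrow> 'a \<Rightarrow>\<^sub>L 'a"
  where "op_sqrt A = (THE B. positive_op B \<and> B o\<^sub>L B = A)"

definition op_adj :: "('a::chilbert_space \<Rightarrow>\<^sub>L 'a) \<Rightarrow> 'a \<Rightarrow>\<^sub>L 'a"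
  where "op_adj A = (THE B. \<forall>x y. cinner (blinfun_apply B x) y = cinner x (A y))"

definition op_abs :: "('a::chilbert_space \<Rightarrow>\<^sub>L 'a) \<Rightarrow> 'a \<Rightarrow>\<^sub>L 'a"
  where "op_abs A = op_sqrt (op_adj A o\<^sub>L A)"

text \<open>Finiteness of the trace of \<open>|A|\<close>. The terms are nonnegative and the value of the sum does
  not depend on the orthonormal basis, so ``some basis'' and ``every basis'' agree.\<close>

definition trace_class :: "('a::chilbert_space \<Rightarrow>\<^sub>L 'a) \<Rightarrow> bool"
  where "trace_class A \<longleftrightarrow>
    clinear_op A \<and> (\<exists>E. is_onb E \<and> (\<lambda>e. cinner e (op_abs A e)) summable_on E)"

end

theory Submission
  imports Defs
begin

text \<open>
  The step from \<open>R\<^sub>n\<close> to \<open>R\<^sub>n\<^sub>+\<^sub>1\<close> subtracts the rank-one operator \<open>|v\<^sub>n\<rangle>\<langle>v\<^sub>n|\<close> with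
  \<open>v\<^sub>n = R\<^sub>n\<^bsup>1/2\<^esup> u\<^sub>n\<close>, and thereby lowers the trace by \<open>\<parallel>v\<^sub>n\<parallel>\<^sup>2 = \<langle>u\<^sub>n, R\<^sub>n u\<^sub>n\<rangle>\<close>. All \<open>R\<^sub>n\<close> are
  positive, so the total amount removed is at most the finite trace of \<open>R\<^sub>0\<close>
  (\<open>sum_removed_trace_le\<close>). The terms of this convergent series tend to \<open>0\<close>, and they dominate
  \<open>c \<parallel>R\<^sub>n\<parallel>\<close>; hence \<open>R\<^sub>n \<rightarrow> 0\<close> in norm, and a strong limit must agree with the norm limit.

  To compare traces it is enough to work with a single orthonormal basis, the one that witnesses
  the trace-class property: Parseval's identity expands each \<open>\<parallel>v\<^sub>n\<parallel>\<^sup>2\<close> over it, and the quadratic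
  forms \<open>\<langle>e, R\<^sub>n e\<rangle>\<close> telescope at each basis vector \<open>e\<close>.

  The square root and the absolute value are given by definite descriptions, so they carry
  information only once the positive square root of a positive operator is known to exist and to
  be unique (\<open>positive_sqrt_ex1\<close>). For a contraction \<open>A\<close> it is \<open>I - B\<close>, where \<open>B\<close> is the norm
  limit of the iteration \<open>B \<mapsto> (X + B\<^sup>2) / 2\<close> with \<open>X = I - A\<close>; the iteration converges because
  the same iteration of real numbers with \<open>X = 1\<close> majorizes it. The limit commutes with
  everything that commutes with \<open>A\<close>, which yields uniqueness.
\<close>

section \<open>Algebra of the inner product\<close>

lemma bounded_bilinear_cinner: "bounded_bilinear (cinner :: 'a::complex_inner \<Rightarrow> 'a \<Rightarrow> complex)"
proof
  show "\<exists>K. \<forall>a b :: 'a. norm (cinner a b) \<le> norm a * norm b * K"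
    by (rule exI[of _ 1]) (simp add: norm_cinner_le)
qed (simp_all add: cinner_add_left cinner_add_right scaleR_scaleC[where 'a = 'a] cinner_scaleC_left
    cinner_scaleC_right scaleR_conv_of_real)

lemmas cinner_diff_left = bounded_bilinear.diff_left[OF bounded_bilinear_cinner]
  and cinner_diff_right = bounded_bilinear.diff_right[OF bounded_bilinear_cinner]
  and cinner_zero_left [simp] = bounded_bilinear.zero_left[OF bounded_bilinear_cinner]
  and cinner_zero_right [simp] = bounded_bilinear.zero_right[OF bounded_bilinear_cinner]
  and cinner_sum_left = bounded_bilinear.sum_left[OF bounded_bilinear_cinner]
  and cinner_sum_right = bounded_bilinear.sum_right[OF bounded_bilinear_cinner]
  and cinner_scaleR_left = bounded_bilinear.scaleR_left[OF bounded_bilinear_cinner]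
  and cinner_scaleR_right = bounded_bilinear.scaleR_right[OF bounded_bilinear_cinner]
  and tendsto_cinner = bounded_bilinear.tendsto[OF bounded_bilinear_cinner]

lemma Re_cinner_self: "Re (cinner x x) = (norm x)\<^sup>2"
  by (simp add: cinner_self)

lemma Re_cinner_commute: "Re (cinner x y) = Re (cinner y x)"
  by (metis cinner_commute cnj.simps(1))

lemma cmod_cinner_commute: "cmod (cinner x y) = cmod (cinner y x)"
  by (metis cinner_commute complex_mod_cnj)

lemma cinner_left_eqI:
  assumes "\<And>y. cinner x y = cinner z y"
  shows "x = z"
proof -
  have "cinner (x - z) (x - z) = 0"
    using assms[of "x - z"] by (simp add: cinner_diff_left)
  then show ?thesis
    by (simp add: cinner_self)
qed

lemma norm_diff_squared:
  "(norm (x - y))\<^sup>2 = (norm x)\<^sup>2 - 2 * Re (cinner x y) + (norm y)\<^sup>2"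
  using Re_cinner_commute[of y x]
  by (simp add: Re_cinner_self[symmetric] cinner_diff_left cinner_diff_right)

section \<open>Parseval's identity\<close>

lemma cinner_sum_orthonormal:
  assumes "finite F" "a \<in> F"
    and "\<And>e. e \<in> F \<Longrightarrow> norm e = 1"
    and "\<And>e f. e \<in> F \<Longrightarrow> f \<in> F \<Longrightarrow> e \<noteq> f \<Longrightarrow> cinner e f = 0"
  shows "cinner a (\<Sum>e\<in>F. r e *\<^sub>C e) = r a"
proof -
  have "cinner a (\<Sum>e\<in>F. r e *\<^sub>C e) = (\<Sum>e\<in>F. if e = a then r a else 0)"
    unfolding cinner_sum_right
    by (rule sum.cong[OF refl]) (use assms in \<open>auto simp: cinner_scaleC_right cinner_self\<close>)
  then show ?thesis
    using assms by simp
qed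

text \<open>Completing the square: among the combinations of a finite orthonormal set, the one with
  the coefficients \<open>cinner e v\<close> is closest to \<open>v\<close>.\<close>

lemma norm_diff_orthonormal_sum:
  fixes v :: "'a::complex_inner"
  assumes F: "finite F"
    "\<And>e. e \<in> F \<Longrightarrow> norm e = 1"
    "\<And>e f. e \<in> F \<Longrightarrow> f \<in> F \<Longrightarrow> e \<noteq> f \<Longrightarrow> cinner e f = 0"
  shows "(norm (v - (\<Sum>e\<in>F. r e *\<^sub>C e)))\<^sup>2
    = (norm v)\<^sup>2 - (\<Sum>e\<in>F. (cmod (cinner e v))\<^sup>2) + (\<Sum>e\<in>F. (cmod (r e - cinner e v))\<^sup>2)"
proof -
  define w where "w = (\<Sum>e\<in>F. r e *\<^sub>C e)"
  have "cinner w w = (\<Sum>e\<in>F. cnj (r e) * cinner e w)"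
    by (subst w_def) (simp add: cinner_sum_left cinner_scaleC_left)
  also have "\<dots> = (\<Sum>e\<in>F. cnj (r e) * r e)"
    by (rule sum.cong) (auto simp: w_def cinner_sum_orthonormal F)
  finally have "Re (cinner w w) = (\<Sum>e\<in>F. Re (cnj (r e) * r e))"
    by simp
  then have ww: "(norm w)\<^sup>2 = (\<Sum>e\<in>F. (cmod (r e))\<^sup>2)"
    unfolding Re_cinner_self by (simp add: cmod_power2 flip: power2_eq_square)
  have vw: "Re (cinner v w) = (\<Sum>e\<in>F. Re (cnj (r e) * cinner e v))"
    unfolding Re_cinner_commute[of v] by (simp add: w_def cinner_sum_left cinner_scaleC_left)
  have "(cmod (r e - cinner e v))\<^sup>2
      = (cmod (r e))\<^sup>2 - 2 * Re (cnj (r e) * cinner e v) + (cmod (cinner e v))\<^sup>2" for e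
    unfolding cmod_power2 by (simp add: power2_eq_square algebra_simps)
  then have "(\<Sum>e\<in>F. (cmod (r e - cinner e v))\<^sup>2)
      = (norm w)\<^sup>2 - 2 * Re (cinner v w) + (\<Sum>e\<in>F. (cmod (cinner e v))\<^sup>2)"
    by (simp add: sum.distrib sum_subtractf sum_distrib_left ww vw)
  then show ?thesis
    unfolding w_def[symmetric] norm_diff_squared by simp
qed

text \<open>Bessel's inequality bounds the partial sums; density of the span and the best-approximation
  property of the coefficients show that nothing is lost in the limit.\<close>

lemma parseval:
  fixes v :: "'a::complex_inner"
  assumes "is_onb E"
  shows "((\<lambda>e. (cmod (cinner e v))\<^sup>2) has_sum (norm v)\<^sup>2) E"
proof -
  let ?f = "\<lambda>e. (cmod (cinner e v))\<^sup>2"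
  have orth: "\<And>e. e \<in> F \<Longrightarrow> norm e = 1"
    "\<And>e f. e \<in> F \<Longrightarrow> f \<in> F \<Longrightarrow> e \<noteq> f \<Longrightarrow> cinner e f = 0" if "F \<subseteq> E" for F
    using assms that unfolding is_onb_def by blast+
  have dense: "closure (cspan E) = UNIV"
    using assms unfolding is_onb_def by simp
  have bessel: "sum ?f F \<le> (norm v)\<^sup>2" if "finite F" "F \<subseteq> E" for F
    using norm_diff_orthonormal_sum[OF that(1) orth[OF that(2)], of v "\<lambda>e. cinner e v"]
      zero_le_power2[of "norm (v - (\<Sum>e\<in>F. cinner e v *\<^sub>C e))"] by simp
  have summable: "?f summable_on E"
    by (rule nonneg_bounded_partial_sums_imp_summable_on[where C = "(norm v)\<^sup>2"])
      (auto intro!: eventually_finite_subsets_at_top_weakI bessel)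
  have "(norm v)\<^sup>2 \<le> infsum ?f E"
  proof (rule field_le_epsilon)
    fix \<epsilon> :: real
    assume "\<epsilon> > 0"
    have "v \<in> closure (cspan E)"
      using dense by simp
    then obtain w where w: "w \<in> cspan E" "dist w v < sqrt \<epsilon>"
      using \<open>\<epsilon> > 0\<close> by (meson closure_approachable real_sqrt_gt_zero)
    then obtain F r where F: "finite F" "F \<subseteq> E" "w = (\<Sum>e\<in>F. r e *\<^sub>C e)"
      unfolding complex_vector.span_explicit by blast
    have "(norm v)\<^sup>2 - sum ?f F \<le> (norm (v - w))\<^sup>2"
      using norm_diff_orthonormal_sum[OF F(1) orth[OF F(2)], of v r]
      by (simp add: F(3) sum_nonneg)
    also have "\<dots> \<le> \<epsilon>"
      using w(2) \<open>\<epsilon> > 0\<close> power_mono[of "dist w v" "sqrt \<epsilon>" 2]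
      by (simp add: dist_norm norm_minus_commute)
    finally have "(norm v)\<^sup>2 - sum ?f F \<le> \<epsilon>" .
    moreover have "sum ?f F \<le> infsum ?f E"
      by (rule finite_sum_le_infsum[OF summable F(1,2)]) simp
    ultimately show "(norm v)\<^sup>2 \<le> infsum ?f E + \<epsilon>"
      by simp
  qed
  moreover have "infsum ?f E \<le> (norm v)\<^sup>2"
    by (rule infsum_le_finite_sums[OF summable bessel])
  ultimately show ?thesis
    using summable by (simp add: has_sum_infsum order_antisym)
qed

section \<open>Positive operators\<close>

definition self_adjoint_op :: "('a::complex_inner \<Rightarrow>\<^sub>L 'a) \<Rightarrow> bool"
  where "self_adjoint_op A \<longleftrightarrow> (\<forall>x y. cinner (A x) y = cinner x (A y))"

lemma self_adjoint_opD: "self_adjoint_op A \<Longrightarrow> cinner (A x) y = cinner x (A y)"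
  by (simp add: self_adjoint_op_def)

text \<open>Scalars can be moved through the inner product together with \<open>A\<close>, so complex linearity need
  not be checked separately for the operators constructed from limits and real combinations.\<close>

lemma self_adjoint_imp_clinear:
  assumes "self_adjoint_op A"
  shows "clinear_op A"
proof -
  have "A (a *\<^sub>C x) = a *\<^sub>C A x" for a x
    by (rule cinner_left_eqI) (simp add: self_adjoint_opD[OF assms] cinner_scaleC_left)
  then show ?thesis
    unfolding clinear_op_def
    by unfold_locales
      (simp_all add: blinfun.add_right scaleC_add_right scaleC_add_left scaleC_scaleC)
qed

text \<open>Polarization: the quadratic form is real at \<open>x + y\<close> and at \<open>x + \<i>y\<close>, which determines
  the imaginary and the real part of the difference of \<open>cinner x (A y)\<close> and the conjugate of
  \<open>cinner y (A x)\<close>.\<close>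

lemma positive_imp_self_adjoint:
  assumes "positive_op A"
  shows "self_adjoint_op A"
proof -
  have real: "Im (cinner z (A z)) = 0" for z
    using assms unfolding positive_op_def by (auto simp: complex_nonneg_Reals_iff)
  interpret A: Vector_Spaces.linear scaleC scaleC "blinfun_apply A"
    using assms unfolding positive_op_def clinear_op_def by blast
  have "cinner (A x) y = cinner x (A y)" for x y
  proof -
    have "Im (cinner x (A y)) = - Im (cinner y (A x))"
      using real[of "x + y"] real[of x] real[of y]
      by (simp add: blinfun.add_right cinner_add_left cinner_add_right)
    moreover have "Re (cinner x (A y)) = Re (cinner y (A x))"
      using real[of "x + \<i> *\<^sub>C y"] real[of x] real[of y]
      by (simp add: A.add A.scale cinner_add_left cinner_add_right
          cinner_scaleC_left cinner_scaleC_right)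
    ultimately show ?thesis
      unfolding cinner_commute[of "A x"] by (simp add: complex_eq_iff)
  qed
  then show ?thesis
    by (simp add: self_adjoint_op_def)
qed

lemma positive_op_iff:
  "positive_op A \<longleftrightarrow> self_adjoint_op A \<and> (\<forall>x. 0 \<le> Re (cinner x (A x)))"
proof -
  have "Im (cinner x (A x)) = 0" if "self_adjoint_op A" for x
    using cinner_commute[of x "A x"] self_adjoint_opD[OF that, of x x]
    by (metis Reals_cnj_iff complex_is_Real_iff)
  moreover have "0 \<le> Re (cinner x (A x))" if "positive_op A" for x
    using that unfolding positive_op_def by (simp add: complex_nonneg_Reals_iff)
  ultimately show ?thesis
    using positive_imp_self_adjoint[of A] self_adjoint_imp_clinear[of A]
    unfolding positive_op_def complex_nonneg_Reals_iff by blast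
qed

lemma positive_opD: "positive_op A \<Longrightarrow> 0 \<le> Re (cinner x (A x))"
  by (simp add: positive_op_iff)

lemma self_adjoint_diff:
  "self_adjoint_op A \<Longrightarrow> self_adjoint_op B \<Longrightarrow> self_adjoint_op (A - B)"
  by (simp add: self_adjoint_op_def blinfun.diff_left cinner_diff_left cinner_diff_right)

lemma self_adjoint_add:
  "self_adjoint_op A \<Longrightarrow> self_adjoint_op B \<Longrightarrow> self_adjoint_op (A + B)"
  by (simp add: self_adjoint_op_def blinfun.add_left cinner_add_left cinner_add_right)

lemma self_adjoint_scaleR: "self_adjoint_op A \<Longrightarrow> self_adjoint_op (r *\<^sub>R A)"
  by (simp add: self_adjoint_op_def blinfun.scaleR_left cinner_scaleR_left cinner_scaleR_right)

lemma self_adjoint_zero: "self_adjoint_op 0"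
  by (simp add: self_adjoint_op_def)

lemma self_adjoint_id: "self_adjoint_op id_blinfun"
  by (simp add: self_adjoint_op_def)

lemma self_adjoint_square: "self_adjoint_op B \<Longrightarrow> self_adjoint_op (B o\<^sub>L B)"
  by (simp add: self_adjoint_op_def)

lemma self_adjoint_limit:
  assumes "B \<longlonglongrightarrow> S" "\<And>n. self_adjoint_op (B n)"
  shows "self_adjoint_op S"
  unfolding self_adjoint_op_def
proof (intro allI)
  fix x y
  have "(\<lambda>n. cinner (B n x) y) \<longlonglongrightarrow> cinner (S x) y"
    by (intro tendsto_cinner blinfun.tendsto assms tendsto_const)
  moreover have "(\<lambda>n. cinner (B n x) y) \<longlonglongrightarrow> cinner x (S y)"
    unfolding self_adjoint_opD[OF assms(2)]
    by (intro tendsto_cinner blinfun.tendsto assms tendsto_const)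
  ultimately show "cinner (S x) y = cinner x (S y)"
    by (rule LIMSEQ_unique)
qed

lemma positive_op_scaleR:
  assumes "positive_op A" "0 \<le> r"
  shows "positive_op (r *\<^sub>R A)"
  using assms
  by (simp add: positive_op_iff self_adjoint_scaleR blinfun.scaleR_left cinner_scaleR_right)

text \<open>Positivity at the vector \<open>x - A x\<close> gives the estimate, because
  \<open>\<langle>A x, A (A x)\<rangle> \<le> \<parallel>A x\<parallel>\<^sup>2\<close> for a contraction.\<close>

lemma positive_contraction_bound:
  assumes A: "positive_op A" and "norm A \<le> 1"
  shows "(norm (A x))\<^sup>2 \<le> Re (cinner x (A x))"
proof -
  have sa: "self_adjoint_op A"
    using A by (simp add: positive_op_iff)
  have "0 \<le> Re (cinner (x - A x) (A (x - A x)))"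
    by (rule positive_opD[OF A])
  also have "\<dots> = Re (cinner x (A x)) - 2 * (norm (A x))\<^sup>2 + Re (cinner (A x) (A (A x)))"
    using self_adjoint_opD[OF sa, of x "A x"]
    by (simp add: Re_cinner_self[symmetric] blinfun.diff_right cinner_diff_left cinner_diff_right)
  also have "Re (cinner (A x) (A (A x))) \<le> norm (A x) * norm (A (A x))"
    by (rule Re_cinner_le)
  also have "\<dots> \<le> norm (A x) * (1 * norm (A x))"
    by (intro mult_left_mono order_trans[OF norm_blinfun] mult_right_mono assms) auto
  finally show ?thesis
    by (simp add: power2_eq_square)
qed

text \<open>After rescaling to a contraction this is a case of the previous estimate.\<close>

lemma positive_op_zeroD:
  assumes A: "positive_op A" and "Re (cinner x (A x)) = 0"
  shows "A x = 0"
proof -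
  let ?r = "inverse (norm A + 1)"
  have "norm (?r *\<^sub>R A) \<le> 1"
    by (simp add: divide_le_eq_1 add_nonneg_pos flip: divide_inverse_commute)
  moreover have "positive_op (?r *\<^sub>R A)"
    by (intro positive_op_scaleR A) simp
  ultimately have "(norm ((?r *\<^sub>R A) x))\<^sup>2 \<le> Re (cinner x ((?r *\<^sub>R A) x))"
    by (intro positive_contraction_bound)
  then have "?r *\<^sub>R A x = 0"
    using assms(2) by (simp add: blinfun.scaleR_left cinner_scaleR_right)
  moreover have "norm A + 1 > 0"
    by (simp add: add_nonneg_pos)
  ultimately show ?thesis
    by simp
qed

lemma norm_id_minus_positive_contraction:
  assumes A: "positive_op A" and "norm A \<le> 1"
  shows "norm (id_blinfun - A) \<le> 1"
proof (rule norm_blinfun_bound)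
  fix x
  have "(norm (x - A x))\<^sup>2 \<le> (norm x)\<^sup>2"
    using positive_contraction_bound[OF assms, of x] positive_opD[OF A, of x]
    by (simp add: norm_diff_squared)
  then show "norm ((id_blinfun - A) x) \<le> 1 * norm x"
    by (simp add: blinfun.diff_left)
qed simp

section \<open>The positive square root\<close>

text \<open>The binomial series of \<open>1 - sqrt (1 - X)\<close> in disguise: a fixed point \<open>B\<close> of the iteration
  satisfies \<open>(1 - B)\<^sup>2 = 1 - X\<close>.\<close>

primrec sqrt_iter :: "('a::complex_inner \<Rightarrow>\<^sub>L 'a) \<Rightarrow> nat \<Rightarrow> 'a \<Rightarrow>\<^sub>L 'a" where
  "sqrt_iter X 0 = 0"
| "sqrt_iter X (Suc n) = (1/2) *\<^sub>R (X + (sqrt_iter X n o\<^sub>L sqrt_iter X n))"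

text \<open>The same iteration for the number \<open>1\<close>. It increases and is bounded, and it majorizes the
  operator iteration for every contraction.\<close>

primrec sqrt_iter_one :: "nat \<Rightarrow> real" where
  "sqrt_iter_one 0 = 0"
| "sqrt_iter_one (Suc n) = (1 + (sqrt_iter_one n)\<^sup>2) / 2"

lemma sqrt_iter_one_bounds: "0 \<le> sqrt_iter_one n \<and> sqrt_iter_one n \<le> 1"
  by (induction n) (auto simp: power_le_one)

lemma incseq_sqrt_iter_one: "incseq sqrt_iter_one"
proof (rule incseq_SucI)
  fix n
  show "sqrt_iter_one n \<le> sqrt_iter_one (Suc n)"
    using zero_le_power2[of "sqrt_iter_one n - 1"] by (simp add: power2_diff field_simps)
qed

lemma norm_sqrt_iter_le:
  assumes "norm X \<le> 1"
  shows "norm (sqrt_iter X n) \<le> sqrt_iter_one n"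
proof (induction n)
  case (Suc n)
  let ?B = "sqrt_iter X n"
  have "norm (X + (?B o\<^sub>L ?B)) \<le> norm X + norm ?B * norm ?B"
    by (rule order_trans[OF norm_triangle_ineq add_left_mono[OF norm_blinfun_compose]])
  also have "\<dots> \<le> 1 + sqrt_iter_one n * sqrt_iter_one n"
    by (intro add_mono mult_mono Suc assms) (auto simp: sqrt_iter_one_bounds)
  finally show ?case
    by (simp add: power2_eq_square)
qed simp

text \<open>Increments are majorized as well, since \<open>B\<^sup>2 - C\<^sup>2 = B (B - C) + (B - C) C\<close> and the
  scalar counterpart of this identity has only nonnegative terms.\<close>

lemma norm_sqrt_iter_diff_le:
  assumes X: "norm X \<le> 1" and "n \<le> m"
  shows "norm (sqrt_iter X m - sqrt_iter X n) \<le> sqrt_iter_one m - sqrt_iter_one n"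
  using assms(2)
proof (induction n arbitrary: m)
  case 0
  then show ?case
    using norm_sqrt_iter_le[OF X] by simp
next
  case (Suc n)
  then obtain k where k: "m = Suc k" "n \<le> k"
    by (cases m) auto
  define B C where "B = sqrt_iter X k" and "C = sqrt_iter X n"
  define b c where "b = sqrt_iter_one k" and "c = sqrt_iter_one n"
  have le: "norm B \<le> b" "norm C \<le> c" "norm (B - C) \<le> b - c" "0 \<le> b" "0 \<le> c"
    using norm_sqrt_iter_le[OF X] Suc.IH[OF k(2)] sqrt_iter_one_bounds
    by (auto simp: B_def C_def b_def c_def)
  have "sqrt_iter X m - sqrt_iter X (Suc n) = (1/2) *\<^sub>R ((B o\<^sub>L B) - (C o\<^sub>L C))"
    by (simp add: k B_def C_def algebra_simps)
  also have "(B o\<^sub>L B) - (C o\<^sub>L C) = (B o\<^sub>L (B - C)) + ((B - C) o\<^sub>L C)"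
    by (rule blinfun_eqI) (simp add: blinfun.bilinear_simps)
  finally have "norm (sqrt_iter X m - sqrt_iter X (Suc n))
      = norm ((B o\<^sub>L (B - C)) + ((B - C) o\<^sub>L C)) / 2"
    by simp
  also have "\<dots> \<le> (norm B * norm (B - C) + norm (B - C) * norm C) / 2"
    by (intro divide_right_mono order_trans[OF norm_triangle_ineq] add_mono norm_blinfun_compose)
      simp
  also have "\<dots> \<le> (b * (b - c) + (b - c) * c) / 2"
    using le order_trans[OF norm_ge_zero le(3)]
    by (intro divide_right_mono add_mono mult_mono) auto
  also have "\<dots> = sqrt_iter_one m - sqrt_iter_one (Suc n)"
    by (simp add: k b_def c_def power2_eq_square field_simps)
  finally show ?case .
qed

lemma convergent_sqrt_iter:
  fixes X :: "'a::chilbert_space \<Rightarrow>\<^sub>L 'a"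
  assumes "norm X \<le> 1"
  shows "convergent (sqrt_iter X)"
proof -
  have "convergent sqrt_iter_one"
    using incseq_convergent[OF incseq_sqrt_iter_one] sqrt_iter_one_bounds
    by (metis convergentI)
  then have cauchy: "Cauchy sqrt_iter_one"
    by (rule convergent_Cauchy)
  have "Cauchy (sqrt_iter X)"
  proof (rule CauchyI')
    fix e :: real
    assume "e > 0"
    then obtain M where M: "\<And>m n. m \<ge> M \<Longrightarrow> n \<ge> M \<Longrightarrow> norm (sqrt_iter_one m - sqrt_iter_one n) < e"
      using CauchyD[OF cauchy] by blast
    have "norm (sqrt_iter X m - sqrt_iter X n) < e" if "M \<le> m" "m < n" for m n
      using norm_sqrt_iter_diff_le[OF assms, of m n] M[of n m] that
      by (simp add: norm_minus_commute)
    then show "\<exists>M. \<forall>m\<ge>M. \<forall>n>m. dist (sqrt_iter X m) (sqrt_iter X n) < e"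
      unfolding dist_norm by blast
  qed
  then show ?thesis
    by (rule Cauchy_convergent)
qed

lemma sqrt_iter_commute:
  assumes "X o\<^sub>L C = C o\<^sub>L X"
  shows "sqrt_iter X n o\<^sub>L C = C o\<^sub>L sqrt_iter X n"
proof (induction n)
  case 0
  show ?case
    by (rule blinfun_eqI) simp
next
  case (Suc n)
  have "X (C x) = C (X x)" "sqrt_iter X n (C x) = C (sqrt_iter X n x)" for x
    using assms Suc by (metis blinfun_apply_blinfun_compose)+
  then show ?case
    by (intro blinfun_eqI) (simp add: blinfun.bilinear_simps)
qed

lemma self_adjoint_sqrt_iter: "self_adjoint_op X \<Longrightarrow> self_adjoint_op (sqrt_iter X n)"
  by (induction n)
    (auto intro!: self_adjoint_zero self_adjoint_scaleR self_adjoint_add self_adjoint_square)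

text \<open>The square root is a norm limit of polynomials in \<open>A\<close>; the commutation clause records the part
  of this that the uniqueness proof needs.\<close>

lemma positive_contraction_sqrt_exists:
  fixes A :: "'a::chilbert_space \<Rightarrow>\<^sub>L 'a"
  assumes A: "positive_op A" and "norm A \<le> 1"
  shows "\<exists>S. positive_op S \<and> S o\<^sub>L S = A \<and> (\<forall>C. A o\<^sub>L C = C o\<^sub>L A \<longrightarrow> S o\<^sub>L C = C o\<^sub>L S)"
proof -
  define X where "X = id_blinfun - A"
  have X: "norm X \<le> 1" "self_adjoint_op X"
    using norm_id_minus_positive_contraction[OF assms] A
    by (auto simp: X_def positive_op_iff intro: self_adjoint_diff self_adjoint_id)
  obtain B where B: "sqrt_iter X \<longlonglongrightarrow> B"
    using convergent_sqrt_iter[OF X(1)] by (auto simp: convergent_def)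
  have "(\<lambda>n. sqrt_iter X (Suc n)) \<longlonglongrightarrow> (1/2) *\<^sub>R (X + (B o\<^sub>L B))"
    unfolding sqrt_iter.simps
    by (intro tendsto_intros bounded_bilinear.tendsto[OF bounded_bilinear_blinfun_compose] B)
  then have fixpoint: "B = (1/2) *\<^sub>R (X + (B o\<^sub>L B))"
    using LIMSEQ_Suc[OF B] LIMSEQ_unique by blast
  have "norm (sqrt_iter X n) \<le> 1" for n
    using norm_sqrt_iter_le[OF X(1), of n] sqrt_iter_one_bounds[of n] by linarith
  then have "norm B \<le> 1"
    using tendsto_norm[OF B] by (meson LIMSEQ_le_const2)
  have sa: "self_adjoint_op (id_blinfun - B)"
    by (intro self_adjoint_diff self_adjoint_id self_adjoint_limit[OF B] self_adjoint_sqrt_iter X)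
  have "Re (cinner x (B x)) \<le> (norm x)\<^sup>2" for x
  proof -
    have "Re (cinner x (B x)) \<le> norm x * norm (B x)"
      by (rule Re_cinner_le)
    also have "\<dots> \<le> norm x * (1 * norm x)"
      using \<open>norm B \<le> 1\<close>
      by (intro mult_left_mono order_trans[OF norm_blinfun] mult_right_mono) auto
    finally show ?thesis
      by (simp add: power2_eq_square)
  qed
  then have "positive_op (id_blinfun - B)"
    using sa by (simp add: positive_op_iff blinfun.diff_left cinner_diff_right Re_cinner_self)
  moreover have "(id_blinfun - B) o\<^sub>L (id_blinfun - B) = A"
  proof (rule blinfun_eqI)
    fix x
    have "2 *\<^sub>R B x = 2 *\<^sub>R ((1/2) *\<^sub>R (X + (B o\<^sub>L B))) x"
      using fixpoint by simp
    also have "\<dots> = x - A x + B (B x)"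
      by (simp add: X_def blinfun.bilinear_simps)
    finally have "x - B x - (B x - B (B x)) = A x"
      by (simp add: scaleR_2 algebra_simps)
    then show "((id_blinfun - B) o\<^sub>L (id_blinfun - B)) x = A x"
      by (simp add: blinfun.bilinear_simps)
  qed
  moreover have "(id_blinfun - B) o\<^sub>L C = C o\<^sub>L (id_blinfun - B)" if "A o\<^sub>L C = C o\<^sub>L A" for C
  proof -
    have "X o\<^sub>L C = C o\<^sub>L X"
      using that unfolding X_def
      by (metis (no_types, lifting) blinfun_apply_blinfun_compose blinfun_apply_id_blinfun
          blinfun_eqI blinfun.diff_left blinfun.diff_right)
    note comm = sqrt_iter_commute[OF this]
    have "(\<lambda>n. sqrt_iter X n o\<^sub>L C) \<longlonglongrightarrow> (B o\<^sub>L C)" "(\<lambda>n. C o\<^sub>L sqrt_iter X n) \<longlonglongrightarrow> (C o\<^sub>L B)"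
      by (intro bounded_bilinear.tendsto[OF bounded_bilinear_blinfun_compose] B tendsto_const)+
    then have "B o\<^sub>L C = C o\<^sub>L B"
      unfolding comm by (rule LIMSEQ_unique)
    then have "B (C x) = C (B x)" for x
      by (metis blinfun_apply_blinfun_compose)
    then show ?thesis
      by (intro blinfun_eqI) (simp add: blinfun.bilinear_simps)
  qed
  ultimately show ?thesis
    by blast
qed

lemma positive_sqrt_exists:
  fixes A :: "'a::chilbert_space \<Rightarrow>\<^sub>L 'a"
  assumes A: "positive_op A"
  shows "\<exists>S. positive_op S \<and> S o\<^sub>L S = A \<and> (\<forall>C. A o\<^sub>L C = C o\<^sub>L A \<longrightarrow> S o\<^sub>L C = C o\<^sub>L S)"
proof -
  define t where "t = norm A + 1"
  have t: "t > 0"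
    unfolding t_def by (simp add: add_nonneg_pos)
  have "positive_op (inverse t *\<^sub>R A)"
    using A t by (intro positive_op_scaleR) auto
  moreover have "norm (inverse t *\<^sub>R A) \<le> 1"
    using t by (simp add: t_def field_simps)
  ultimately obtain S where S: "positive_op S" "S o\<^sub>L S = inverse t *\<^sub>R A"
    "\<And>C. (inverse t *\<^sub>R A) o\<^sub>L C = C o\<^sub>L (inverse t *\<^sub>R A) \<Longrightarrow> S o\<^sub>L C = C o\<^sub>L S"
    using positive_contraction_sqrt_exists by metis
  note scale = bounded_bilinear.scaleR_left[OF bounded_bilinear_blinfun_compose]
    bounded_bilinear.scaleR_right[OF bounded_bilinear_blinfun_compose]
  show ?thesis
  proof (intro exI conjI allI impI)
    show "positive_op (sqrt t *\<^sub>R S)"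
      using S(1) t by (intro positive_op_scaleR) auto
    show "(sqrt t *\<^sub>R S) o\<^sub>L (sqrt t *\<^sub>R S) = A"
      using t by (simp add: scale S(2) mult.assoc[symmetric])
    show "(sqrt t *\<^sub>R S) o\<^sub>L C = C o\<^sub>L (sqrt t *\<^sub>R S)" if "A o\<^sub>L C = C o\<^sub>L A" for C
      using S(3)[of C] that by (simp add: scale)
  qed
qed

text \<open>If \<open>S\<close> and \<open>C\<close> commute and have the same square, then \<open>(S + C) (S - C) = 0\<close>. So both
  quadratic forms vanish on the range of \<open>S - C\<close>, hence so do \<open>S\<close> and \<open>C\<close>, and
  \<open>(S - C)\<^sup>2 = 0\<close>.\<close>

lemma commuting_positive_sqrt_unique:
  fixes S C :: "'a::complex_inner \<Rightarrow>\<^sub>L 'a"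
  assumes S: "positive_op S" and C: "positive_op C"
    and sq: "S o\<^sub>L S = C o\<^sub>L C" and comm: "S o\<^sub>L C = C o\<^sub>L S"
  shows "S = C"
proof (rule blinfun_eqI)
  fix x
  define y where "y = S x - C x"
  have "S (S x) = C (C x)" "S (C x) = C (S x)"
    using sq comm by (metis blinfun_apply_blinfun_compose)+
  then have "S y + C y = 0"
    by (simp add: y_def blinfun.diff_right)
  then have "Re (cinner y (S y)) + Re (cinner y (C y)) = 0"
    by (metis cinner_add_right cinner_zero_right plus_complex.sel(1) zero_complex.sel(1))
  then have "Re (cinner y (S y)) = 0" "Re (cinner y (C y)) = 0"
    using positive_opD[OF S, of y] positive_opD[OF C, of y] by linarith+
  then have zero: "S y = 0" "C y = 0"
    using positive_op_zeroD S C by blast+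
  have sa: "self_adjoint_op S" "self_adjoint_op C"
    using S C by (auto simp: positive_op_iff)
  have "cinner y y = cinner x (S y) - cinner x (C y)"
    by (subst y_def) (simp add: cinner_diff_left self_adjoint_opD[OF sa(1)] self_adjoint_opD[OF sa(2)])
  then have "y = 0"
    using zero by (simp add: cinner_self)
  then show "S x = C x"
    by (simp add: y_def)
qed

lemma positive_sqrt_ex1:
  fixes A :: "'a::chilbert_space \<Rightarrow>\<^sub>L 'a"
  assumes "positive_op A"
  shows "\<exists>!B. positive_op B \<and> B o\<^sub>L B = A"
proof -
  obtain S where S: "positive_op S" "S o\<^sub>L S = A"
    "\<And>C. A o\<^sub>L C = C o\<^sub>L A \<Longrightarrow> S o\<^sub>L C = C o\<^sub>L S"
    using positive_sqrt_exists[OF assms] by blast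
  have "S = C" if C: "positive_op C" "C o\<^sub>L C = A" for C
  proof (rule commuting_positive_sqrt_unique[OF S(1) C(1)])
    show "S o\<^sub>L S = C o\<^sub>L C"
      using S(2) C(2) by simp
    \<comment> \<open>\<open>C\<close> commutes with its own square \<open>A\<close>.\<close>
    show "S o\<^sub>L C = C o\<^sub>L S"
      by (rule S(3)) (unfold C(2)[symmetric], rule blinfun_eqI, simp)
  qed
  then show ?thesis
    using S by blast
qed

lemma op_sqrt_positive: "positive_op A \<Longrightarrow> positive_op (op_sqrt A)"
  and op_sqrt_square: "positive_op A \<Longrightarrow> op_sqrt A o\<^sub>L op_sqrt A = A"
  using theI'[OF positive_sqrt_ex1[of A]] unfolding op_sqrt_def by blast+

lemma op_sqrt_unique:
  assumes "positive_op B" "positive_op A" "B o\<^sub>L B = A"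
  shows "op_sqrt A = B"
  unfolding op_sqrt_def using assms by (intro the1_equality positive_sqrt_ex1) auto

text \<open>This lets the trace-class property of a positive operator speak about its own quadratic
  form.\<close>

lemma op_abs_positive:
  fixes A :: "'a::chilbert_space \<Rightarrow>\<^sub>L 'a"
  assumes A: "positive_op A"
  shows "op_abs A = A"
proof -
  have sa: "self_adjoint_op A"
    using A by (simp add: positive_op_iff)
  have "op_adj A = A"
    unfolding op_adj_def
  proof (rule the_equality)
    show "\<forall>x y. cinner (A x) y = cinner x (A y)"
      using sa by (simp add: self_adjoint_op_def)
    show "B = A" if "\<forall>x y. cinner (blinfun_apply B x) y = cinner x (A y)" for B
      by (rule blinfun_eqI, rule cinner_left_eqI) (simp add: that self_adjoint_opD[OF sa])
  qed
  moreover have "cinner x (A (A x)) = cinner (A x) (A x)" for x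
    by (simp add: self_adjoint_opD[OF sa])
  then have "positive_op (A o\<^sub>L A)"
    by (simp add: positive_op_iff self_adjoint_square[OF sa] Re_cinner_self)
  ultimately show ?thesis
    unfolding op_abs_def using A by (simp add: op_sqrt_unique)
qed

section \<open>One step of the recursion\<close>

lemma ketbra_apply: "ketbra a b x = cinner b x *\<^sub>C a"
  by (simp add: ketbra.rep_eq)

lemma cinner_op_sqrt_left:
  assumes "positive_op A"
  shows "cinner (op_sqrt A x) y = cinner x (op_sqrt A y)"
  using op_sqrt_positive[OF assms] by (simp add: positive_op_iff self_adjoint_opD)

lemma norm_op_sqrt:
  assumes "positive_op A"
  shows "(norm (op_sqrt A x))\<^sup>2 = Re (cinner x (A x))"
proof -
  have "op_sqrt A (op_sqrt A x) = A x"
    by (metis op_sqrt_square[OF assms] blinfun_apply_blinfun_compose)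
  then show ?thesis
    by (simp add: Re_cinner_self[symmetric] cinner_op_sqrt_left[OF assms])
qed

text \<open>By self-adjointness of the root, \<open>A\<^bsup>1/2\<^esup> |u\<rangle>\<langle>u| A\<^bsup>1/2\<^esup> = |v\<rangle>\<langle>v|\<close> with
  \<open>v = A\<^bsup>1/2\<^esup> u\<close>, whose quadratic form at \<open>x\<close> is the subtracted square.\<close>

lemma Re_cinner_rank_one_step:
  fixes A :: "'a::chilbert_space \<Rightarrow>\<^sub>L 'a"
  assumes A: "positive_op A"
  shows "Re (cinner x ((op_sqrt A o\<^sub>L (id_blinfun - ketbra u u) o\<^sub>L op_sqrt A) x))
    = Re (cinner x (A x)) - (cmod (cinner x (op_sqrt A u)))\<^sup>2"
proof -
  let ?z = "op_sqrt A x"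
  have "cinner x ((op_sqrt A o\<^sub>L (id_blinfun - ketbra u u) o\<^sub>L op_sqrt A) x)
      = cinner ?z (?z - cinner u ?z *\<^sub>C u)"
    by (simp add: cinner_op_sqrt_left[OF A] blinfun.diff_left ketbra_apply)
  also have "\<dots> = cinner ?z ?z - cinner u ?z * cnj (cinner u ?z)"
    using cinner_commute[of ?z u] by (simp add: cinner_diff_right cinner_scaleC_right)
  also have "Re \<dots> = (norm ?z)\<^sup>2 - (cmod (cinner u ?z))\<^sup>2"
    by (simp add: Re_cinner_self complex_mult_cnj cmod_power2)
  also have "cmod (cinner u ?z) = cmod (cinner x (op_sqrt A u))"
    by (simp add: cmod_cinner_commute[of u] cinner_op_sqrt_left[OF A])
  finally show ?thesis
    by (simp add: norm_op_sqrt[OF A])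
qed

lemma positive_rank_one_step:
  fixes A :: "'a::chilbert_space \<Rightarrow>\<^sub>L 'a"
  assumes A: "positive_op A" and u: "norm u \<le> 1"
  shows "positive_op (op_sqrt A o\<^sub>L (id_blinfun - ketbra u u) o\<^sub>L op_sqrt A)"
  unfolding positive_op_iff
proof (intro conjI allI)
  have "cinner (cinner u x *\<^sub>C u) y = cinner x (cinner u y *\<^sub>C u)" for x y
    using cinner_commute[of x u] by (simp add: cinner_scaleC_left cinner_scaleC_right)
  then show "self_adjoint_op (op_sqrt A o\<^sub>L (id_blinfun - ketbra u u) o\<^sub>L op_sqrt A)"
    by (simp add: self_adjoint_op_def cinner_op_sqrt_left[OF A] blinfun.bilinear_simps
        ketbra_apply cinner_diff_left cinner_diff_right)
  show "0 \<le> Re (cinner x ((op_sqrt A o\<^sub>L (id_blinfun - ketbra u u) o\<^sub>L op_sqrt A) x))" for x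
  proof -
    have "cmod (cinner x (op_sqrt A u)) = cmod (cinner (op_sqrt A x) u)"
      by (simp add: cinner_op_sqrt_left[OF A])
    also have "\<dots> \<le> norm (op_sqrt A x) * norm u"
      by (rule norm_cinner_le)
    also have "\<dots> \<le> norm (op_sqrt A x)"
      using u by (simp add: mult_left_le)
    finally have "(cmod (cinner x (op_sqrt A u)))\<^sup>2 \<le> (norm (op_sqrt A x))\<^sup>2"
      by (intro power_mono) auto
    then show ?thesis
      unfolding Re_cinner_rank_one_step[OF A] by (simp add: norm_op_sqrt[OF A])
  qed
qed

section \<open>The trace bound\<close>

text \<open>The sum of the quantities \<open>\<langle>u\<^sub>k, R\<^sub>k u\<^sub>k\<rangle> = \<parallel>R\<^sub>k\<^bsup>1/2\<^esup> u\<^sub>k\<parallel>\<^sup>2\<close> for \<open>k < n\<close> is the trace of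
  \<open>R\<^sub>0 - R\<^sub>n\<close>: expand each norm over the basis by Parseval's identity and telescope the quadratic
  form at each basis vector.\<close>

lemma sum_removed_trace_le:
  fixes R :: "nat \<Rightarrow> 'a::chilbert_space \<Rightarrow>\<^sub>L 'a" and u :: "nat \<Rightarrow> 'a"
  assumes onb: "is_onb E" and trace: "(\<lambda>e. Re (cinner e (R 0 e))) summable_on E"
    and pos: "\<And>n. positive_op (R n)"
    and step: "\<And>n. R (Suc n) =
      op_sqrt (R n) o\<^sub>L (id_blinfun - ketbra (u n) (u n)) o\<^sub>L op_sqrt (R n)"
  shows "(\<Sum>k<n. Re (cinner (u k) (R k (u k)))) \<le> (\<Sum>\<^sub>\<infinity>e\<in>E. Re (cinner e (R 0 e)))"
proof -
  define v where "v k = op_sqrt (R k) (u k)" for k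
  have telescope: "(\<Sum>k<n. (cmod (cinner e (v k)))\<^sup>2)
      = Re (cinner e (R 0 e)) - Re (cinner e (R n e))" for e n
    by (induction n)
      (simp_all add: v_def step Re_cinner_rank_one_step[OF pos] del: blinfun_apply_blinfun_compose)
  have "((\<lambda>e. \<Sum>k<n. (cmod (cinner e (v k)))\<^sup>2) has_sum (\<Sum>k<n. (norm (v k))\<^sup>2)) E"
    by (induction n) (auto intro!: has_sum_add parseval onb)
  then have "(\<Sum>k<n. (norm (v k))\<^sup>2) \<le> (\<Sum>\<^sub>\<infinity>e\<in>E. Re (cinner e (R 0 e)))"
    by (rule has_sum_mono[OF _ has_sum_infsum[OF trace]])
      (unfold telescope, simp add: positive_opD[OF pos])
  then show ?thesis
    by (simp add: v_def norm_op_sqrt[OF pos])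
qed

theorem corollary3p9:
  fixes R :: "nat \<Rightarrow> 'a::chilbert_space \<Rightarrow>\<^sub>L 'a"
    and u :: "nat \<Rightarrow> 'a"
    and c :: real
  assumes "trace_class (R 0)"
    and "positive_op (R 0)"
    and "\<And>n. norm (u n) = 1"
    and "\<And>n. R (Suc n) =
      op_sqrt (R n) o\<^sub>L (id_blinfun - ketbra (u n) (u n)) o\<^sub>L op_sqrt (R n)"
    and "0 < c" and "c \<le> 1"
    and "\<And>n. Re (cinner (u n) (R n (u n))) \<ge> c * norm (R n)"
  shows "R \<longlonglongrightarrow> 0 \<and>
    (\<forall>R_inf. limitin strong_operator_topology R R_inf sequentially \<longrightarrow> R_inf = 0)"
proof -
  have pos: "positive_op (R n)" for n
  proof (induction n)
    case (Suc n)
    then show ?case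
      unfolding assms(4)[of n] by (rule positive_rank_one_step) (simp add: assms(3))
  qed (rule assms(2))
  obtain E where E: "is_onb E" "(\<lambda>e. cinner e (R 0 e)) summable_on E"
    using assms(1) unfolding trace_class_def op_abs_positive[OF assms(2)] by auto
  let ?d = "\<lambda>n. Re (cinner (u n) (R n (u n)))"
  have "summable ?d"
  proof (rule summableI_nonneg_bounded)
    show "0 \<le> ?d n" for n
      by (rule positive_opD[OF pos])
    show "(\<Sum>k<n. ?d k) \<le> (\<Sum>\<^sub>\<infinity>e\<in>E. Re (cinner e (R 0 e)))" for n
      by (rule sum_removed_trace_le[OF E(1) summable_on_Re[OF E(2)] pos assms(4)])
  qed
  then have lim: "?d \<longlonglongrightarrow> 0"
    by (rule summable_LIMSEQ_zero)
  have bound: "norm (R n) \<le> ?d n / c" for n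
    using assms(5) assms(7)[of n] by (simp add: field_simps)
  have lim': "(\<lambda>n. ?d n / c) \<longlonglongrightarrow> 0"
    using tendsto_divide[OF lim tendsto_const[of c]] assms(5) by simp
  have R: "R \<longlonglongrightarrow> 0"
    by (rule Lim_null_comparison[OF eventuallyI[OF bound] lim'])
  have "S = 0" if S: "limitin strong_operator_topology R S sequentially" for S
  proof (rule blinfun_eqI)
    fix x
    have "limitin euclidean ((\<lambda>f. blinfun_apply f x) \<circ> R) (S x) sequentially"
      by (rule continuous_map_limit[OF strong_operator_topology_continuous_evaluation S])
    then have "(\<lambda>n. R n x) \<longlonglongrightarrow> S x"
      by (simp add: o_def)
    moreover have "(\<lambda>n. R n x) \<longlonglongrightarrow> (0 :: 'a \<Rightarrow>\<^sub>L 'a) x"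
      by (intro blinfun.tendsto R tendsto_const)
    ultimately show "S x = (0 :: 'a \<Rightarrow>\<^sub>L 'a) x"
      by (rule LIMSEQ_unique)
  qed
  with R show ?thesis
    by blast
qed

end
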